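(* Let $a_0,a_1,b_0,b_1$ be real numbers such that $a(N):=a_1N+a_0>0$ and $b(N):=b_1N+b_0>0$ for every positive integer $N$. For every integer $k\geq1$, letting $I_k(N)$ denote $I_k$ computed with $N$ variables and parameters $a=a(N)$, $b=b(N)$, one has $$\lim_{N\to\infty}\frac{I_k(N)}{N}=\frac{1+a_1}{k(2+a_1+b_1)^k}\sum_{j=0}^{k-1}(-1)^j\left(\frac{1+a_1}{2+a_1+b_1}\right)^j\binom{j+k-1}{j}\sum_{i=0}^{k-1-j}(1+a_1)^i\binom{k}{i+j+1}\binom{k}{i}.$$
   Context: For a positive integer $N$, real numbers $a,b>0$ and a function $f$ of $N$ variables, set $\langle f\rangle_{a,b}=\frac1{N!}\int_{[0,1]^N}f(x_1,\dots,x_N)\prod_{1\le i<j\le N}(x_i-x_j)^2\prod_{i=1}^Nx_i^{a-1}(1-x_i)^{b-1}\,dx_i$. Let $p_k(x_1,\dots,x_N)=\sum_{i=1}^N x_i^k$ and $I_k:=\langle p_k\rangle_{a,b}/\langle 1\rangle_{a,b}$. *)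

theory Defs
  imports "HOL-Analysis.Analysis"
begin

definition jacobi_weight :: "nat \<Rightarrow> real \<Rightarrow> real \<Rightarrow> (nat \<Rightarrow> real) \<Rightarrow> real" where
  "jacobi_weight N a b x =
     (\<Prod>i<N. \<Prod>j\<in>{i<..<N}. (x i - x j)^2) *
     (\<Prod>i<N. x i powr (a - 1) * (1 - x i) powr (b - 1))"

definition selberg_avg :: "nat \<Rightarrow> real \<Rightarrow> real \<Rightarrow> ((nat \<Rightarrow> real) \<Rightarrow> real) \<Rightarrow> real" where
  "selberg_avg N a b f =
     (1 / fact N) *
     (\<integral>x \<in> (PiE {..<N} (\<lambda>_. {0..1::real})).
        f x * jacobi_weight N a b x \<partial>(PiM {..<N} (\<lambda>_. lborel)))"

definition power_sum :: "nat \<Rightarrow> nat \<Rightarrow> (nat \<Rightarrow> real) \<Rightarrow> real" where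
  "power_sum N k x = (\<Sum>i<N. x i ^ k)"

definition moment_I :: "nat \<Rightarrow> real \<Rightarrow> real \<Rightarrow> nat \<Rightarrow> real" where
  "moment_I N a b k = selberg_avg N a b (power_sum N k) / selberg_avg N a b (\<lambda>_. 1)"

end

theory Submission
  imports Defs "Jordan_Normal_Form.Determinant" "HOL-Computational_Algebra.Formal_Power_Series"
begin

text \<open>Multiplying the alternant of the exponents \<open>0, \<dots>, N - 1\<close> by \<open>p_k\<close> gives the sum over \<open>l\<close> of the
  alternants in which the exponent \<open>l\<close> is raised by \<open>k\<close>.  By Andreief's identity each term integrates
  to a determinant of Beta values, which is a product of Gamma factors and a Vandermonde
  determinant in the exponents.  Hence
  \<open>k! I_k(N) = \<Sum>r<k. (-1)^r (k-1 choose r) G(N - r)\<close> is a \<open>(k-1)\<close>-st backward difference of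
  \<open>G(x) = \<Prod>c<k. (x + c) (x + c + a - 1) / (x + c + a + b + N - 2)\<close>.  After rescaling by \<open>N\<close> it is a divided
  difference at the nodes \<open>1 - r/N\<close> of functions converging to
  \<open>((1 + a1 + u) (1 + u) / (2 + a1 + b1 + u))^k\<close> with \<open>u = x/N - 1\<close>, so the limit is the coefficient of
  \<open>u^(k-1)\<close> there, divided by \<open>k\<close>.  The Leibniz rule for divided differences reduces that convergence
  to the linear factors and their reciprocals.\<close>

section \<open>Alternants and Andreief's identity\<close>

text \<open>Taking entries as a plain function on indices lets matrices be written as lambda terms;
  only indices below \<open>n\<close> matter.\<close>

definition det_fun :: "nat \<Rightarrow> (nat \<Rightarrow> nat \<Rightarrow> real) \<Rightarrow> real" where
  "det_fun n A = Determinant.det (mat n n (\<lambda>(i, j). A i j))"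

lemma det_fun_leibniz:
  "det_fun n A = (\<Sum>p | p permutes {..<n}. of_int (sign p) * (\<Prod>i<n. A i (p i)))"
  unfolding det_fun_def det_def'[OF mat_carrier]
  by (intro sum.cong arg_cong2[of _ _ _ _ "(*)"] prod.cong) (auto simp: atLeast0LessThan permutes_nat_less)

lemma det_fun_cong:
  assumes "\<And>i j. i < n \<Longrightarrow> j < n \<Longrightarrow> A i j = B i j"
  shows "det_fun n A = det_fun n B"
  unfolding det_fun_def using assms by (intro arg_cong[of _ _ Determinant.det]) auto

lemma det_fun_mult:
  "det_fun n (\<lambda>i j. \<Sum>m<n. A i m * B m j) = det_fun n A * det_fun n B"
proof -
  have "mat n n (\<lambda>(i, j). \<Sum>m<n. A i m * B m j)
      = mat n n (\<lambda>(i, j). A i j) * mat n n (\<lambda>(i, j). B i j)"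
    by (rule eq_matI) (auto simp: scalar_prod_def atLeast0LessThan)
  then show ?thesis
    unfolding det_fun_def by (simp add: det_mult[of _ n])
qed

lemma det_fun_lower_triangular:
  assumes "\<And>i j. i < j \<Longrightarrow> j < n \<Longrightarrow> A i j = 0"
  shows "det_fun n A = (\<Prod>i<n. A i i)"
proof -
  have "det_fun n A = prod_list (diag_mat (mat n n (\<lambda>(i, j). A i j)))"
    unfolding det_fun_def by (rule det_lower_triangular[of n]) (use assms in auto)
  then show ?thesis
    by (simp add: prod_list_diag_prod atLeast0LessThan)
qed

lemma det_fun_upper_triangular:
  assumes "\<And>i j. j < i \<Longrightarrow> i < n \<Longrightarrow> A i j = 0"
  shows "det_fun n A = (\<Prod>i<n. A i i)"
proof -
  have "det_fun n A = prod_list (diag_mat (mat n n (\<lambda>(i, j). A i j)))"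
    unfolding det_fun_def by (rule det_upper_triangular[of _ n]) (use assms in auto)
  then show ?thesis
    by (simp add: prod_list_diag_prod atLeast0LessThan)
qed

lemma det_fun_permute_rows:
  assumes p: "p permutes {..<n}"
  shows "det_fun n (\<lambda>i j. A (p i) j) = of_int (sign p) * det_fun n A"
proof -
  have p': "p permutes {0..<n}" using p by (simp add: atLeast0LessThan)
  have "mat n n (\<lambda>(i, j). mat n n (\<lambda>(i, j). A i j) $$ (p i, j)) = mat n n (\<lambda>(i, j). A (p i) j)"
    by (rule eq_matI) (use permutes_in_image[OF p'] in auto)
  then show ?thesis
    using det_permute_rows[OF mat_carrier p', of "\<lambda>(i, j). A i j"] by (simp add: det_fun_def)
qed

lemma det_fun_scale_rows:
  "det_fun n (\<lambda>i j. c i * A i j) = (\<Prod>i<n. c i) * det_fun n A"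
  unfolding det_fun_leibniz by (simp add: prod.distrib sum_distrib_left mult_ac)

text \<open>Evaluation factors as the matrix of powers of the nodes times the matrix of
  coefficients. The degree bound makes both factors \<open>n\<close> by \<open>n\<close>, so the
  determinant is multiplicative.\<close>

lemma det_fun_poly:
  assumes "\<And>j. j < n \<Longrightarrow> degree (q j) < n"
  shows "det_fun n (\<lambda>i j. poly (q j) (y i))
       = det_fun n (\<lambda>i j. y i ^ j) * det_fun n (\<lambda>m j. coeff (q j) m)"
proof -
  have "poly (q j) t = (\<Sum>m<n. t ^ m * coeff (q j) m)" if "j < n" for j t
    unfolding poly_altdef using assms[OF that]
    by (intro sum.mono_neutral_cong_left) (auto simp: coeff_eq_0 mult_ac)
  then have "det_fun n (\<lambda>i j. poly (q j) (y i))
      = det_fun n (\<lambda>i j. \<Sum>m<n. y i ^ m * coeff (q j) m)"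
    by (intro det_fun_cong) auto
  then show ?thesis by (simp add: det_fun_mult)
qed

text \<open>Passing to the Newton basis \<open>q j\<close>, the product of the X -
  \<open>y i\<close> for i < j, makes the value matrix lower triangular, since \<open>q j\<close>
  vanishes at earlier nodes. The \<open>q j\<close> are monic of degree \<open>j\<close>, so the
  change of basis has determinant 1.\<close>

lemma vandermonde:
  "det_fun n (\<lambda>i j. y i ^ j) = (\<Prod>j<n. \<Prod>i<j. y j - y i)"
proof -
  define q where "q j = (\<Prod>i<j. [:- y i, 1:])" for j
  have deg: "degree (q j) = j" for j
    unfolding q_def by (subst degree_prod_eq_sum_degree) auto
  have lead: "coeff (q j) j = 1" for j
  proof -
    have "lead_coeff (q j) = 1" unfolding q_def by (subst lead_coeff_prod) auto
    then show ?thesis by (simp add: deg)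
  qed
  have "det_fun n (\<lambda>i j. poly (q j) (y i)) = (\<Prod>j<n. poly (q j) (y j))"
    by (rule det_fun_lower_triangular) (auto simp: q_def poly_prod intro!: prod_zero)
  moreover have "det_fun n (\<lambda>m j. coeff (q j) m) = 1"
    by (subst det_fun_upper_triangular) (auto simp: coeff_eq_0 deg lead)
  moreover have "det_fun n (\<lambda>i j. poly (q j) (y i))
       = det_fun n (\<lambda>i j. y i ^ j) * det_fun n (\<lambda>m j. coeff (q j) m)"
    by (rule det_fun_poly) (simp add: deg)
  ultimately show ?thesis by (simp add: q_def poly_prod)
qed

text \<open>Expanding both determinants over permutations \<open>p\<close> and \<open>q\<close>
  leaves products of one-variable integrals. For fixed \<open>p\<close> the sum over
  \<open>q\<close> is the determinant with rows permuted by \<open>p\<close>, so every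
  \<open>p\<close> contributes the same amount.\<close>

lemma andreief:
  fixes f g :: "nat \<Rightarrow> real \<Rightarrow> real"
  assumes int: "\<And>i j. i < n \<Longrightarrow> j < n \<Longrightarrow> integrable lborel (\<lambda>x. f i x * g j x)"
  shows "has_bochner_integral (PiM {..<n} (\<lambda>_. lborel))
           (\<lambda>x. det_fun n (\<lambda>i j. f j (x i)) * det_fun n (\<lambda>i j. g j (x i)))
           (fact n * det_fun n (\<lambda>i j. \<integral>x. f i x * g j x \<partial>lborel))"
proof -
  interpret product_sigma_finite "\<lambda>_::nat. lborel :: real measure"
    by standard
  define I where "I i j = (\<integral>x. f i x * g j x \<partial>lborel)" for i j
  let ?P = "{p. p permutes {..<n}}"
  let ?M = "PiM {..<n} (\<lambda>_. lborel :: real measure)"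
  have prod: "has_bochner_integral ?M (\<lambda>x. \<Prod>i<n. f (p i) (x i) * g (q i) (x i))
      (\<Prod>i<n. I (p i) (q i))"
    if "p permutes {..<n}" "q permutes {..<n}" for p q
  proof -
    have "integrable lborel (\<lambda>x. f (p i) x * g (q i) x)" if "i \<in> {..<n}" for i
      using that permutes_in_image[OF \<open>p permutes _\<close>, of i] permutes_in_image[OF \<open>q permutes _\<close>, of i]
      by (intro int) auto
    then show ?thesis
      unfolding has_bochner_integral_iff I_def
      by (auto intro!: product_integrable_prod product_integral_prod)
  qed
  have "has_bochner_integral ?M
      (\<lambda>x. \<Sum>p\<in>?P. \<Sum>q\<in>?P. (of_int (sign p) * of_int (sign q)) * (\<Prod>i<n. f (p i) (x i) * g (q i) (x i)))
      (\<Sum>p\<in>?P. \<Sum>q\<in>?P. (of_int (sign p) * of_int (sign q)) * (\<Prod>i<n. I (p i) (q i)))"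
    by (intro has_bochner_integral_sum has_bochner_integral_mult_right prod) auto
  also have "(\<lambda>x. \<Sum>p\<in>?P. \<Sum>q\<in>?P. (of_int (sign p) * of_int (sign q)) *
        (\<Prod>i<n. f (p i) (x i) * g (q i) (x i)))
      = (\<lambda>x. det_fun n (\<lambda>i j. f j (x i)) * det_fun n (\<lambda>i j. g j (x i)))"
    by (simp add: det_fun_leibniz sum_product prod.distrib mult_ac)
  also have "(\<Sum>p\<in>?P. \<Sum>q\<in>?P. (of_int (sign p) * of_int (sign q)) * (\<Prod>i<n. I (p i) (q i)))
      = (\<Sum>p\<in>?P. of_int (sign p) * det_fun n (\<lambda>i j. I (p i) j))"
    by (simp add: det_fun_leibniz sum_distrib_left mult_ac)
  \<comment> \<open>The sign from the row permutation meets the sign from the Leibniz expansion, and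
    their product is 1.\<close>
  also have "\<dots> = (\<Sum>p\<in>?P. det_fun n I)"
    by (intro sum.cong) (auto simp: det_fun_permute_rows sign_def)
  also have "\<dots> = fact n * det_fun n I"
    by (simp add: card_permutations)
  finally show ?thesis unfolding I_def .
qed

text \<open>In the Leibniz term of \<open>p\<close>, the factor \<open>y l ^ k\<close> raises the
  exponent \<open>p l\<close> by \<open>k\<close>. Summing over the variable \<open>l\<close> is the
  same as summing over the raised exponent, because \<open>p\<close> is a bijection.\<close>

lemma power_sum_times_alternant:
  "power_sum n k y * det_fun n (\<lambda>i j. y i ^ j)
     = (\<Sum>l<n. det_fun n (\<lambda>i j. y i ^ (j + (if j = l then k else 0))))"
proof -
  have eq: "power_sum n k y * (\<Prod>i<n. y i ^ p i)
      = (\<Sum>l<n. \<Prod>i<n. y i ^ (p i + (if p i = l then k else 0)))"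
    if p: "p permutes {..<n}" for p
  proof -
    have "(\<Sum>l<n. \<Prod>i<n. y i ^ (p i + (if p i = l then k else 0)))
        = (\<Sum>l<n. \<Prod>i<n. y i ^ (p i + (if p i = p l then k else 0)))"
      by (rule sum.permute[OF p, unfolded o_def])
    also have "\<dots> = (\<Sum>l<n. y l ^ k * (\<Prod>i<n. y i ^ p i))"
    proof (rule sum.cong)
      fix l assume "l \<in> {..<n}"
      have "(\<Prod>i<n. y i ^ (p i + (if p i = p l then k else 0)))
          = (\<Prod>i<n. (if i = l then y i ^ k else 1) * y i ^ p i)"
        using inj_eq[OF permutes_inj[OF p]] by (intro prod.cong) (auto simp: power_add)
      also have "\<dots> = y l ^ k * (\<Prod>i<n. y i ^ p i)"
        using \<open>l \<in> {..<n}\<close> by (simp add: prod.distrib prod.delta)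
      finally show "(\<Prod>i<n. y i ^ (p i + (if p i = p l then k else 0))) = y l ^ k * (\<Prod>i<n. y i ^ p i)" .
    qed simp
    finally show ?thesis by (simp add: power_sum_def sum_distrib_right)
  qed
  have "power_sum n k y * det_fun n (\<lambda>i j. y i ^ j)
      = (\<Sum>p | p permutes {..<n}. of_int (sign p) * (power_sum n k y * (\<Prod>i<n. y i ^ p i)))"
    by (simp add: det_fun_leibniz sum_distrib_left mult_ac)
  also have "\<dots> = (\<Sum>p | p permutes {..<n}. \<Sum>l<n. of_int (sign p) *
      (\<Prod>i<n. y i ^ (p i + (if p i = l then k else 0))))"
    by (intro sum.cong) (auto simp: eq sum_distrib_left)
  also have "\<dots> = (\<Sum>l<n. det_fun n (\<lambda>i j. y i ^ (j + (if j = l then k else 0))))"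
    unfolding det_fun_leibniz by (rule sum.swap)
  finally show ?thesis .
qed

section \<open>The exact formula for the moments\<close>

lemma has_bochner_integral_beta_moment:
  fixes a b :: real
  assumes "a > 0" "b > 0"
  shows "has_bochner_integral lborel
      (\<lambda>x. indicator {0..1} x * (x powr (a - 1) * (1 - x) powr (b - 1)) * x ^ m) (Beta (a + m) b)"
proof -
  let ?f = "\<lambda>x::real. x powr (a + m - 1) * (1 - x) powr (b - 1)"
  have hi: "(?f has_integral Beta (a + m) b) {0..1}"
    using assms by (intro has_integral_Beta_real) auto
  \<comment> \<open>The integrand is nonnegative, so the gauge integral over the interval transfers
    to Lebesgue measure, and integrability for exponents near the endpoints comes for free.\<close>
  then have nn: "(\<integral>\<^sup>+x. ennreal (indicator {0..1} x * ?f x) \<partial>lborel) = ennreal (Beta (a + m) b)"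
    by (subst nn_integral_has_integral_lebesgue[symmetric, OF _ hi])
       (auto simp: nn_integral_completion mult_ac indicator_def intro!: nn_integral_cong)
  have "Beta (a + m) b \<ge> 0"
    using assms by (intro has_integral_nonneg[OF hi]) auto
  then have "has_bochner_integral lborel (\<lambda>x. indicator {0..1} x * ?f x) (Beta (a + m) b)"
    by (intro has_bochner_integral_nn_integral nn) auto
  \<comment> \<open>At \<open>x = 0\<close> both sides are 0, because \<open>0 powr z = 0\<close>
    for every \<open>z\<close>.\<close>
  moreover have "x powr (a - 1) * x ^ m = x powr (a + m - 1)" if "x \<ge> 0" for x :: real
    using that by (cases "x = 0") (auto simp: powr_add[symmetric] powr_realpow[symmetric] algebra_simps)
  ultimately show ?thesis
    by (elim has_bochner_integral_cong[THEN iffD1, rotated -1])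
       (auto simp: indicator_def mult_ac)
qed

text \<open>Exhibits two copies of the alternant: one is multiplied by the power sum, the other
  serves as the second determinant in Andreief's identity.\<close>

lemma jacobi_weight_eq:
  "jacobi_weight N a b x = det_fun N (\<lambda>i j. x i ^ j) ^ 2 *
     (\<Prod>i<N. x i powr (a - 1) * (1 - x i) powr (b - 1))"
proof -
  have "(\<Prod>i<N. \<Prod>j\<in>{i<..<N}. (x i - x j)^2) = (\<Prod>i\<in>{..<N}. \<Prod>j\<in>{j\<in>{..<N}. i < j}. (x j - x i)^2)"
    by (intro prod.cong) (auto simp: power2_commute)
  also have "\<dots> = (\<Prod>j\<in>{..<N}. \<Prod>i\<in>{i\<in>{..<N}. i < j}. (x j - x i)^2)"
    by (rule prod.swap_restrict) auto
  also have "\<dots> = (\<Prod>j<N. \<Prod>i<j. (x j - x i)^2)"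
    by (intro prod.cong) auto
  finally show ?thesis
    by (simp add: jacobi_weight_def vandermonde prod_power_distrib)
qed

text \<open>Andreief's identity applies on the whole space once the one-variable weight
  \<open>W\<close>, cut off to the unit interval, is absorbed into the rows of the first
  determinant.\<close>

lemma has_bochner_integral_alternants:
  fixes a b :: real and e :: "nat \<Rightarrow> nat"
  assumes "a > 0" "b > 0"
  shows "has_bochner_integral (PiM {..<N} (\<lambda>_. lborel))
      (\<lambda>x. indicator (PiE {..<N} (\<lambda>_. {0..1})) x *
        (det_fun N (\<lambda>i j. x i ^ e j) * det_fun N (\<lambda>i j. x i ^ j) *
        (\<Prod>i<N. x i powr (a - 1) * (1 - x i) powr (b - 1))))
      (fact N * det_fun N (\<lambda>i j. Beta (a + real (e i + j)) b))"
proof -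
  define W where "W = (\<lambda>x::real. indicator {0..1} x * (x powr (a - 1) * (1 - x) powr (b - 1)))"
  have W: "has_bochner_integral lborel (\<lambda>x. W x * x ^ e i * x ^ j) (Beta (a + real (e i + j)) b)" for i j
    using has_bochner_integral_beta_moment[OF assms, of "e i + j"] by (simp add: W_def power_add mult_ac)
  have "has_bochner_integral (PiM {..<N} (\<lambda>_. lborel))
      (\<lambda>x. det_fun N (\<lambda>i j. W (x i) * x i ^ e j) * det_fun N (\<lambda>i j. x i ^ j))
      (fact N * det_fun N (\<lambda>i j. \<integral>x. W x * x ^ e i * x ^ j \<partial>lborel))"
    by (rule andreief) (use W in \<open>auto simp: has_bochner_integral_iff\<close>)
  also have "(\<lambda>i j. \<integral>x. W x * x ^ e i * x ^ j \<partial>lborel) = (\<lambda>i j. Beta (a + real (e i + j)) b)"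
    using W by (simp add: has_bochner_integral_iff)
  finally show ?thesis
  proof (elim has_bochner_integral_cong[THEN iffD1, rotated -1])
    fix x assume "x \<in> space (PiM {..<N} (\<lambda>_. lborel :: real measure))"
    \<comment> \<open>Membership in \<open>PiE\<close> also asks for the default value outside the
      index set. Points of the product space have it, so the product of the indicators is the
      indicator of the cube.\<close>
    then have ext: "x \<in> extensional {..<N}"
      by (auto simp: space_PiM PiE_def)
    have "(\<Prod>i<N. indicator {0..1} (x i)) = (indicator (PiE {..<N} (\<lambda>_. {0..1})) x :: real)"
    proof (cases "\<forall>i<N. x i \<in> {0..1}")
      case True
      then show ?thesis using ext by (auto simp: PiE_def Pi_def indicator_def)
    next
      case False
      then obtain i where i: "i < N" "x i \<notin> {0..1}" by auto
      then have "(\<Prod>i<N. indicator {0..1} (x i) :: real) = 0"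
        by (intro prod_zero) (auto intro!: bexI[of _ i])
      moreover have "x \<notin> PiE {..<N} (\<lambda>_. {0..1})" using i by (auto simp: PiE_def Pi_def)
      ultimately show ?thesis by simp
    qed
    then show "det_fun N (\<lambda>i j. W (x i) * x i ^ e j) * det_fun N (\<lambda>i j. x i ^ j)
        = indicator (PiE {..<N} (\<lambda>_. {0..1})) x *
        (det_fun N (\<lambda>i j. x i ^ e j) * det_fun N (\<lambda>i j. x i ^ j) *
        (\<Prod>i<N. x i powr (a - 1) * (1 - x i) powr (b - 1)))"
      by (subst det_fun_scale_rows) (simp add: W_def prod.distrib mult_ac)
  qed auto
qed

lemma selberg_avg_1:
  assumes "a > 0" "b > 0"
  shows "selberg_avg N a b (\<lambda>_. 1) = det_fun N (\<lambda>i j. Beta (a + real (i + j)) b)"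
  using has_bochner_integral_alternants[OF assms, of N "\<lambda>i. i"]
  by (simp add: selberg_avg_def set_lebesgue_integral_def jacobi_weight_eq power2_eq_square
      has_bochner_integral_iff)

lemma selberg_avg_power_sum:
  assumes "a > 0" "b > 0"
  shows "selberg_avg N a b (power_sum N k) =
    (\<Sum>l<N. det_fun N (\<lambda>i j. Beta (a + real (i + (if i = l then k else 0) + j)) b))"
proof -
  let ?P = "\<lambda>x. \<Prod>i<N. x i powr (a - 1) * (1 - x i) powr (b - 1)"
  let ?V = "\<lambda>x. det_fun N (\<lambda>i j. x i ^ j)"
  have "has_bochner_integral (PiM {..<N} (\<lambda>_. lborel))
      (\<lambda>x. \<Sum>l<N. indicator (PiE {..<N} (\<lambda>_. {0..1})) x *
        (det_fun N (\<lambda>i j. x i ^ (j + (if j = l then k else 0))) * ?V x * ?P x))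
      (\<Sum>l<N. fact N * det_fun N (\<lambda>i j. Beta (a + real (i + (if i = l then k else 0) + j)) b))"
    by (intro has_bochner_integral_sum has_bochner_integral_alternants assms)
  also have "(\<lambda>x. \<Sum>l<N. indicator (PiE {..<N} (\<lambda>_. {0..1})) x *
        (det_fun N (\<lambda>i j. x i ^ (j + (if j = l then k else 0))) * ?V x * ?P x))
      = (\<lambda>x. indicator (PiE {..<N} (\<lambda>_. {0..1})) x * (power_sum N k x * jacobi_weight N a b x))"
  proof
    fix x
    have "power_sum N k x * jacobi_weight N a b x = (power_sum N k x * ?V x) * ?V x * ?P x"
      by (simp add: jacobi_weight_eq power2_eq_square mult_ac)
    then show "(\<Sum>l<N. indicator (PiE {..<N} (\<lambda>_. {0..1})) x *
        (det_fun N (\<lambda>i j. x i ^ (j + (if j = l then k else 0))) * ?V x * ?P x))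
      = indicator (PiE {..<N} (\<lambda>_. {0..1})) x * (power_sum N k x * jacobi_weight N a b x)"
      by (simp only: power_sum_times_alternant sum_distrib_left sum_distrib_right)
  qed
  finally show ?thesis
    by (simp add: selberg_avg_def set_lebesgue_integral_def has_bochner_integral_iff
        sum_distrib_left[symmetric])
qed

section \<open>Evaluation of the Beta determinants\<close>

lemma Gamma_plus_nat:
  fixes z :: real
  assumes "z > 0"
  shows "Gamma (z + real n) = Gamma z * (\<Prod>i<n. z + real i)"
proof (induction n)
  case (Suc n)
  have "Gamma (z + real n + 1) = (z + real n) * Gamma (z + real n)"
    using assms by (intro Gamma_plus1) (auto elim!: nonpos_Ints_cases')
  with Suc show ?case by (simp add: add_ac mult_ac)
qed auto

text \<open>Multiplying the entry \<open>Beta (a + e + j) b\<close> by a factor that depends only on \<open>e\<close> leaves a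
  polynomial in \<open>e\<close> of degree \<open>N - 1\<close>; so the determinant is a Vandermonde determinant in
  the exponents up to a constant.\<close>

definition beta_poly :: "nat \<Rightarrow> real \<Rightarrow> real \<Rightarrow> nat \<Rightarrow> real poly" where
  "beta_poly N a b j = (\<Prod>i<j. [:a + real i, 1:]) * (\<Prod>i\<in>{j..<N-1}. [:a + b + real i, 1:])"

definition beta_factor :: "nat \<Rightarrow> real \<Rightarrow> real \<Rightarrow> nat \<Rightarrow> real" where
  "beta_factor N a b e = Gamma b * Gamma (a + real e) / Gamma (a + b + real e + real (N - 1))"

lemma poly_beta_poly:
  "poly (beta_poly N a b j) t = (\<Prod>i<j. a + t + real i) * (\<Prod>i\<in>{j..<N-1}. a + b + t + real i)"
  by (simp add: beta_poly_def poly_prod add_ac)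

lemma degree_beta_poly:
  assumes "j < N"
  shows "degree (beta_poly N a b j) < N"
proof -
  have "degree (\<Prod>i\<in>A. [:c i, 1:]) = card A" if "finite A" for A :: "nat set" and c :: "nat \<Rightarrow> real"
    using that by (subst degree_prod_eq_sum_degree) auto
  then have "degree (beta_poly N a b j) = j + (N - 1 - j)"
    unfolding beta_poly_def by (subst degree_mult_eq) auto
  with assms show ?thesis by simp
qed

text \<open>The numerator's Gamma value grows by \<open>j\<close> linear factors. In the denominator
  the argument is pushed up to the common value \<open>a + b + e + N - 1\<close>, and the
  compensating factors \<open>j..<N-1\<close> move to the numerator.\<close>

lemma Beta_eq_beta_poly:
  assumes "a > 0" "b > 0" "j < N"
  shows "Beta (a + real (e + j)) b = beta_factor N a b e * poly (beta_poly N a b j) (real e)"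
proof -
  let ?z = "a + b + real e"
  have 1: "Gamma (a + real (e + j)) = Gamma (a + real e) * (\<Prod>i<j. a + real e + real i)"
    using Gamma_plus_nat[of "a + real e" j] assms by (simp add: add_ac)
  have 2: "Gamma (?z + real j) = Gamma ?z * (\<Prod>i<j. ?z + real i)"
    "Gamma (?z + real (N - 1)) = Gamma ?z * (\<Prod>i<N-1. ?z + real i)"
    using assms by (intro Gamma_plus_nat; simp)+
  have "{..<N-1} = {..<j} \<union> {j..<N-1}" "{..<j} \<inter> {j..<N-1} = {}" using assms by auto
  then have 3: "(\<Prod>i<N-1. ?z + real i) = (\<Prod>i<j. ?z + real i) * (\<Prod>i\<in>{j..<N-1}. ?z + real i)"
    by (simp add: prod.union_disjoint)
  define P where "P = (\<Prod>i\<in>{j..<N-1}. ?z + real i)"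
  have "P > 0" unfolding P_def using assms by (intro prod_pos) auto
  moreover have "Gamma (?z + real j) > 0" using assms by (intro Gamma_real_pos) auto
  moreover have "Gamma (?z + real (N - 1)) = Gamma (?z + real j) * P"
    using 2 3 by (simp add: P_def)
  moreover have 4: "a + real (e + j) + b = ?z + real j" by simp
  ultimately show ?thesis
    unfolding Beta_def beta_factor_def poly_beta_poly 1 4 P_def[symmetric]
    by (simp del: of_nat_add of_nat_diff)
qed

text \<open>The last determinant does not involve \<open>e\<close>, so it cancels between the raised
  and the unraised exponents.\<close>

lemma det_Beta:
  assumes "a > 0" "b > 0"
  shows "det_fun N (\<lambda>i j. Beta (a + real (e i + j)) b) =
    (\<Prod>i<N. beta_factor N a b (e i)) * (\<Prod>j<N. \<Prod>i<j. real (e j) - real (e i)) *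
    det_fun N (\<lambda>m j. coeff (beta_poly N a b j) m)"
proof -
  have "det_fun N (\<lambda>i j. Beta (a + real (e i + j)) b) =
      det_fun N (\<lambda>i j. beta_factor N a b (e i) * poly (beta_poly N a b j) (real (e i)))"
    by (intro det_fun_cong Beta_eq_beta_poly assms)
  then show ?thesis
    by (simp add: det_fun_scale_rows det_fun_poly degree_beta_poly vandermonde)
qed

lemma det_coeff_beta_poly_nonzero:
  assumes "b > 0"
  shows "det_fun N (\<lambda>m j. coeff (beta_poly N a b j) m) \<noteq> 0"
proof -
  text \<open>At the points \<open>-(a + i)\<close> the matrix of values is triangular.\<close>
  have "det_fun N (\<lambda>i j. poly (beta_poly N a b j) (- (a + real i)))
      = (\<Prod>i<N. poly (beta_poly N a b i) (- (a + real i)))"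
    by (rule det_fun_lower_triangular) (auto simp: poly_beta_poly intro!: prod_zero)
  also have "\<dots> \<noteq> 0"
  proof -
    \<comment> \<open>The factors of the first product are t - i with t < i, those of the second b +
      t - i with t at least i.\<close>
    have "poly (beta_poly N a b i) (- (a + real i)) \<noteq> 0" for i
      using assms by (auto simp: poly_beta_poly)
    then show ?thesis by simp
  qed
  also have "det_fun N (\<lambda>i j. poly (beta_poly N a b j) (- (a + real i)))
      = det_fun N (\<lambda>i j. (- (a + real i)) ^ j) * det_fun N (\<lambda>m j. coeff (beta_poly N a b j) m)"
    by (rule det_fun_poly) (rule degree_beta_poly)
  finally show ?thesis by auto
qed

lemma beta_factor_pos:
  assumes "a > 0" "b > 0"
  shows "beta_factor N a b e > 0"
  using assms by (auto simp: beta_factor_def intro!: divide_pos_pos mult_pos_pos Gamma_real_pos)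

lemma beta_factor_add:
  assumes "a > 0" "b > 0"
  shows "beta_factor N a b (e + k) / beta_factor N a b e =
    (\<Prod>d<k. (a + real e + real d) / (a + b + real e + real (N - 1) + real d))"
proof -
  let ?z = "a + b + real e + real (N - 1)"
  have "Gamma (a + real (e + k)) = Gamma (a + real e) * (\<Prod>d<k. a + real e + real d)"
    using Gamma_plus_nat[of "a + real e" k] assms by (simp add: add_ac)
  moreover have "Gamma (a + b + real (e + k) + real (N - 1)) = Gamma ?z * (\<Prod>d<k. ?z + real d)"
    using Gamma_plus_nat[of ?z k] assms by (simp add: add_ac)
  moreover have "Gamma b > 0" "Gamma (a + real e) > 0" "Gamma ?z > 0"
    using assms by (auto intro!: Gamma_real_pos)
  ultimately show ?thesis
    by (simp add: beta_factor_def prod_dividef)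
qed

text \<open>Isolates the factors that contain \<open>y l\<close>; the third product is common to all
  sequences differing only at \<open>l\<close>.\<close>

lemma vandermonde_split:
  fixes y :: "nat \<Rightarrow> real"
  assumes "l < n"
  shows "(\<Prod>j<n. \<Prod>i<j. y j - y i) =
    (\<Prod>i<l. y l - y i) * (\<Prod>j\<in>{l<..<n}. y j - y l) *
    (\<Prod>j\<in>{..<n}-{l}. \<Prod>i\<in>{..<j}-{l}. y j - y i)"
proof -
  have "(\<Prod>j<n. \<Prod>i<j. y j - y i) =
      (\<Prod>i<l. y l - y i) * (\<Prod>j\<in>{..<n}-{l}. \<Prod>i<j. y j - y i)"
    using assms by (simp add: prod.remove)
  also have "(\<Prod>j\<in>{..<n}-{l}. \<Prod>i<j. y j - y i) =
      (\<Prod>j\<in>{..<n}-{l}. (if l < j then y j - y l else 1) * (\<Prod>i\<in>{..<j}-{l}. y j - y i))"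
  proof (intro prod.cong refl)
    fix j assume "j \<in> {..<n} - {l}"
    show "(\<Prod>i<j. y j - y i) = (if l < j then y j - y l else 1) * (\<Prod>i\<in>{..<j}-{l}. y j - y i)"
    proof (cases "l < j")
      case True
      then show ?thesis by (simp add: prod.remove[of "{..<j}" l])
    next
      case False
      then have "{..<j} - {l} = {..<j}" by auto
      with False show ?thesis by simp
    qed
  qed
  also have "\<dots> = (\<Prod>j\<in>{..<n}-{l}. if l < j then y j - y l else 1) *
      (\<Prod>j\<in>{..<n}-{l}. \<Prod>i\<in>{..<j}-{l}. y j - y i)"
    by (rule prod.distrib)
  also have "(\<Prod>j\<in>{..<n}-{l}. if l < j then y j - y l else 1) = (\<Prod>j\<in>{l<..<n}. y j - y l)"
    by (rule prod.mono_neutral_cong_right) auto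
  finally show ?thesis by (simp add: mult_ac)
qed

lemma prod_diff_nat_gbinomial:
  "(\<Prod>i<n. c - real i) = fact n * (c gchoose n)"
  by (simp add: gbinomial_mult_fact atLeast0LessThan)

text \<open>Here \<open>r\<close> counts the exponents above \<open>l\<close>. Lower indices
  contribute the binomial in \<open>l + k\<close>, higher ones the signed binomial in
  \<open>k - 1\<close>. The latter is 0 for \<open>r\<close> at least \<open>k\<close>, when the
  raised exponent collides with another one.\<close>

lemma vandermonde_shift_ratio:
  fixes k l r :: nat
  assumes "k \<ge> 1"
  defines "n \<equiv> l + 1 + r"
  defines "e \<equiv> (\<lambda>i. i + (if i = l then k else 0))"
  shows "(\<Prod>j<n. \<Prod>i<j. real (e j) - real (e i)) =
    (-1) ^ r * real (k - 1 choose r) * real (l + k choose k) * (\<Prod>j<n. \<Prod>i<j. real j - real i)"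
proof -
  let ?R = "\<Prod>j\<in>{..<n}-{l}. \<Prod>i\<in>{..<j}-{l}. real j - real i"
  \<comment> \<open>Used twice: \<open>c = l + k\<close> for the raised exponent,
    \<open>c = l\<close> for the original one, where the sign cancels and \<open>fact r\<close>
    remains.\<close>
  have shift: "(\<Prod>j\<in>{l<..<n}. real j - c) = (-1) ^ r * (\<Prod>d<r. (c - real l - 1) - real d)" for c
  proof -
    have "(\<Prod>j\<in>{l<..<n}. real j - c) = (\<Prod>d<r. - ((c - real l - 1) - real d))"
      by (rule prod.reindex_bij_witness[of _ "\<lambda>d. d + l + 1" "\<lambda>j. j - l - 1"])
         (auto simp: n_def algebra_simps)
    also have "\<dots> = (-1) ^ r * (\<Prod>d<r. (c - real l - 1) - real d)"
      using prod.distrib[of "\<lambda>_. -1" "\<lambda>d. (c - real l - 1) - real d" "{..<r}"] by simp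
    finally show ?thesis .
  qed
  have "(\<Prod>j<n. \<Prod>i<j. real (e j) - real (e i)) =
      (\<Prod>i<l. real (l + k) - real i) * (\<Prod>j\<in>{l<..<n}. real j - real (l + k)) * ?R"
    by (subst vandermonde_split[of l]) (auto simp: n_def e_def intro!: arg_cong2[of _ _ _ _ "(*)"] prod.cong)
  also have "(\<Prod>i<l. real (l + k) - real i) = fact l * real (l + k choose k)"
    using binomial_symmetric[of l "l + k"]
    by (simp only: prod_diff_nat_gbinomial binomial_gbinomial[symmetric]) simp
  also have "(\<Prod>j\<in>{l<..<n}. real j - real (l + k)) = (-1) ^ r * (fact r * real (k - 1 choose r))"
  proof -
    have "real (l + k) - real l - 1 = real (k - 1)" using assms(1) by simp
    then show ?thesis
      by (simp only: shift prod_diff_nat_gbinomial binomial_gbinomial[symmetric])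
  qed
  finally have 1: "(\<Prod>j<n. \<Prod>i<j. real (e j) - real (e i)) =
    fact l * real (l + k choose k) * ((-1) ^ r * (fact r * real (k - 1 choose r))) * ?R" .
  have "(\<Prod>j<n. \<Prod>i<j. real j - real i) =
      (\<Prod>i<l. real l - real i) * (\<Prod>j\<in>{l<..<n}. real j - real l) * ?R"
    by (rule vandermonde_split) (simp add: n_def)
  also have "(\<Prod>i<l. real l - real i) = fact l"
    by (simp add: prod_diff_nat_gbinomial binomial_gbinomial[symmetric])
  also have "(\<Prod>j\<in>{l<..<n}. real j - real l) = fact r"
    by (simp add: shift prod_diff_nat_gbinomial gbinomial_minus flip: power_mult_distrib binomial_gbinomial)
  finally show ?thesis unfolding 1 by (simp add: mult_ac)
qed

text \<open>Every determinant in numerator and denominator shares the nonzero factor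
  \<open>?B * ?V * ?C\<close>. Counting from the top exponent, \<open>r = N - 1 - l\<close>, turns
  the quotient into an alternating binomial sum.\<close>

lemma moment_I_eq:
  assumes "a > 0" "b > 0" "k \<ge> 1"
  shows "moment_I N a b k = (\<Sum>r<N. (-1) ^ r * real (k - 1 choose r) * real (N - 1 - r + k choose k) *
    (\<Prod>d<k. (a + real (N - 1 - r) + real d) / (a + b + real (N - 1 - r) + real (N - 1) + real d)))"
proof -
  let ?C = "det_fun N (\<lambda>m j. coeff (beta_poly N a b j) m)"
  let ?V = "\<Prod>j<N. \<Prod>i<j. real j - real i"
  let ?B = "\<Prod>i<N. beta_factor N a b i"
  have B: "?B > 0" by (intro prod_pos) (auto simp: beta_factor_pos assms)
  have V: "?V > 0" by (intro prod_pos) auto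
  have denom: "selberg_avg N a b (\<lambda>_. 1) = ?B * ?V * ?C"
    using det_Beta[OF assms(1,2), of N "\<lambda>i. i"] by (simp add: selberg_avg_1 assms)
  have "det_fun N (\<lambda>i j. Beta (a + real (i + (if i = l then k else 0) + j)) b) =
      (-1) ^ (N - 1 - l) * real (k - 1 choose (N - 1 - l)) * real (l + k choose k) *
      (\<Prod>d<k. (a + real l + real d) / (a + b + real l + real (N - 1) + real d)) * (?B * ?V * ?C)"
    if l: "l < N" for l
  proof -
    have "(\<Prod>i<N. beta_factor N a b (i + (if i = l then k else 0))) =
        (\<Prod>i<N. (if i = l then beta_factor N a b (l + k) / beta_factor N a b l else 1) * beta_factor N a b i)"
      using beta_factor_pos[OF assms(1,2), of N l] by (intro prod.cong) auto
    also have "\<dots> = beta_factor N a b (l + k) / beta_factor N a b l * ?B"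
      using l by (subst prod.distrib) simp
    finally have 1: "(\<Prod>i<N. beta_factor N a b (i + (if i = l then k else 0))) =
        (\<Prod>d<k. (a + real l + real d) / (a + b + real l + real (N - 1) + real d)) * ?B"
      by (simp add: beta_factor_add assms)
    have "l + 1 + (N - 1 - l) = N" using l by simp
    from vandermonde_shift_ratio[OF assms(3), of l "N - 1 - l", unfolded this]
    show ?thesis unfolding det_Beta[OF assms(1,2)] 1 by (simp only: mult_ac)
  qed
  then have "selberg_avg N a b (power_sum N k) =
      (\<Sum>l<N. (-1) ^ (N - 1 - l) * real (k - 1 choose (N - 1 - l)) * real (l + k choose k) *
      (\<Prod>d<k. (a + real l + real d) / (a + b + real l + real (N - 1) + real d))) * (?B * ?V * ?C)"
    by (simp add: selberg_avg_power_sum assms sum_distrib_right)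
  moreover have "?B * ?V * ?C \<noteq> 0"
    using less_imp_neq[OF B, symmetric] less_imp_neq[OF V, symmetric]
      det_coeff_beta_poly_nonzero[OF assms(2), of N a]
    by (simp only: mult_eq_0_iff simp_thms)
  ultimately have "moment_I N a b k =
      (\<Sum>l<N. (-1) ^ (N - 1 - l) * real (k - 1 choose (N - 1 - l)) * real (l + k choose k) *
      (\<Prod>d<k. (a + real l + real d) / (a + b + real l + real (N - 1) + real d)))"
    by (simp add: moment_I_def denom)
  also have "\<dots> = (\<Sum>r<N. (-1) ^ r * real (k - 1 choose r) * real (N - 1 - r + k choose k) *
    (\<Prod>d<k. (a + real (N - 1 - r) + real d) / (a + b + real (N - 1 - r) + real (N - 1) + real d)))"
    by (rule sum.reindex_bij_witness[of _ "\<lambda>r. N - 1 - r" "\<lambda>l. N - 1 - l"]) auto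
  finally show ?thesis .
qed

section \<open>Divided differences and Taylor coefficients\<close>

text \<open>Newton's divided difference of order \<open>m\<close> over equally spaced descending
  nodes of step \<open>h\<close>, starting at node number \<open>s\<close>; \<open>f\<close> takes
  the number of the node instead of its position.\<close>

fun divided_diff :: "real \<Rightarrow> (nat \<Rightarrow> real) \<Rightarrow> nat \<Rightarrow> nat \<Rightarrow> real" where
  "divided_diff h f s 0 = f s"
| "divided_diff h f s (Suc m) = (divided_diff h f s m - divided_diff h f (Suc s) m) / (h * real (Suc m))"

lemma divided_diff_Suc:
  assumes "h \<noteq> 0"
  shows "h * real (Suc m) * divided_diff h f s (Suc m) = divided_diff h f s m - divided_diff h f (Suc s) m"
  using assms by (simp del: of_nat_Suc)

text \<open>Links the alternating sum for the moments to divided differences; the induction step is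
  Pascal's rule.\<close>

lemma divided_diff_eq_sum:
  assumes "h \<noteq> 0"
  shows "fact m * h ^ m * divided_diff h f s m = (\<Sum>r\<le>m. (-1) ^ r * real (m choose r) * f (s + r))"
proof (induction m arbitrary: s)
  case (Suc m)
  have "fact (Suc m) * h ^ Suc m * divided_diff h f s (Suc m) =
      fact m * h ^ m * (h * real (Suc m) * divided_diff h f s (Suc m))"
    by (simp add: algebra_simps del: divided_diff.simps)
  also have "\<dots> = fact m * h ^ m * divided_diff h f s m - fact m * h ^ m * divided_diff h f (Suc s) m"
    unfolding divided_diff_Suc[OF assms] by (simp add: algebra_simps)
  also have "\<dots> = (\<Sum>r\<le>m. (-1) ^ r * real (m choose r) * f (s + r)) -
      (\<Sum>r\<le>m. (-1) ^ r * real (m choose r) * f (s + Suc r))"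
    by (simp add: Suc)
  also have "(\<Sum>r\<le>m. (-1) ^ r * real (m choose r) * f (s + r)) =
      (\<Sum>r\<le>Suc m. (-1) ^ r * real (m choose r) * f (s + r))"
    by simp
  also have "\<dots> = f s + (\<Sum>r\<le>m. (-1) ^ Suc r * real (m choose Suc r) * f (s + Suc r))"
    by (subst sum.atMost_Suc_shift) simp
  also have "\<dots> - (\<Sum>r\<le>m. (-1) ^ r * real (m choose r) * f (s + Suc r)) =
      f s + (\<Sum>r\<le>m. (-1) ^ Suc r * real (Suc m choose Suc r) * f (s + Suc r))"
    by (simp add: sum.distrib sum_subtractf sum_negf algebra_simps)
  also have "\<dots> = (\<Sum>r\<le>Suc m. (-1) ^ r * real (Suc m choose r) * f (s + r))"
    by (subst sum.atMost_Suc_shift) simp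
  finally show ?case .
qed simp

text \<open>Leibniz rule for divided differences. Differencing the \<open>p\<close>-th product at
  \<open>s\<close> and \<open>Suc s\<close> gives weighted copies of the terms \<open>T p\<close>
  and \<open>T (Suc p)\<close> of the next order.\<close>

lemma divided_diff_mult:
  assumes "h \<noteq> 0"
  shows "divided_diff h (\<lambda>r. f r * g r) s m =
    (\<Sum>p\<le>m. divided_diff h f s p * divided_diff h g (s + p) (m - p))"
proof (induction m arbitrary: s)
  case (Suc m)
  let ?F = "divided_diff h f" and ?G = "divided_diff h g"
  define T where "T p = ?F s p * ?G (s + p) (Suc m - p)" for p
  have "?F s p * ?G (s + p) (m - p) - ?F (Suc s) p * ?G (Suc s + p) (m - p) =
      h * (real (Suc m - p) * T p + real (Suc p) * T (Suc p))" if "p \<le> m" for p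
  proof -
    have "?F s p * ?G (s + p) (m - p) - ?F (Suc s) p * ?G (Suc s + p) (m - p) =
        ?F s p * (?G (s + p) (m - p) - ?G (Suc (s + p)) (m - p)) +
        (?F s p - ?F (Suc s) p) * ?G (Suc (s + p)) (m - p)"
      by (simp add: algebra_simps)
    also have "\<dots> = h * (real (Suc m - p) * T p + real (Suc p) * T (Suc p))"
      unfolding divided_diff_Suc[OF assms, symmetric] T_def using that by (simp add: Suc_diff_le algebra_simps del: divided_diff.simps)
    finally show ?thesis .
  qed
  then have "divided_diff h (\<lambda>r. f r * g r) s m - divided_diff h (\<lambda>r. f r * g r) (Suc s) m =
      h * ((\<Sum>p\<le>m. real (Suc m - p) * T p) + (\<Sum>p\<le>m. real (Suc p) * T (Suc p)))"
    by (simp add: Suc sum_subtractf[symmetric] sum.distrib[symmetric] sum_distrib_left del: of_nat_Suc)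
  \<comment> \<open>Both sums extend to all \<open>p\<close> up to \<open>Suc m\<close> by a term of
    weight 0, at \<open>p = Suc m\<close> and at \<open>p = 0\<close> respectively; then the two
    weights of each \<open>T p\<close> add up to \<open>Suc m\<close>.\<close>
  also have "(\<Sum>p\<le>m. real (Suc m - p) * T p) = (\<Sum>p\<le>Suc m. real (Suc m - p) * T p)"
    by simp
  also have "(\<Sum>p\<le>m. real (Suc p) * T (Suc p)) = (\<Sum>p\<le>Suc m. real p * T p)"
    by (subst sum.atMost_Suc_shift) simp
  also have "(\<Sum>p\<le>Suc m. real (Suc m - p) * T p) + (\<Sum>p\<le>Suc m. real p * T p) =
      (\<Sum>p\<le>Suc m. real (Suc m) * T p)"
    by (subst sum.distrib[symmetric], intro sum.cong)
       (auto simp: distrib_right[symmetric] of_nat_add[symmetric] simp del: of_nat_add of_nat_Suc)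
  also have "\<dots> = real (Suc m) * (\<Sum>p\<le>Suc m. T p)"
    by (simp only: sum_distrib_left)
  finally show ?case
    using assms by (simp add: T_def del: of_nat_Suc sum.atMost_Suc)
qed simp

text \<open>The value \<open>f N r\<close> belongs to the node \<open>1 - r / N\<close>, and \<open>\<phi>\<close> is the Taylor series at \<open>1\<close> of the
  limit function.\<close>

definition taylor_limit :: "(nat \<Rightarrow> nat \<Rightarrow> real) \<Rightarrow> real fps \<Rightarrow> bool" where
  "taylor_limit f \<phi> \<longleftrightarrow> (\<forall>s m. (\<lambda>N. divided_diff (1 / real N) (f N) s m) \<longlonglongrightarrow> fps_nth \<phi> m)"

text \<open>The Leibniz rule starts the second factor at \<open>s + p\<close>, which is why
  \<open>taylor_limit\<close> ranges over all starting nodes. The limiting sum is the Cauchy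
  product.\<close>

lemma taylor_limit_mult:
  assumes "taylor_limit f \<phi>" "taylor_limit g \<psi>"
  shows "taylor_limit (\<lambda>N r. f N r * g N r) (\<phi> * \<psi>)"
  unfolding taylor_limit_def
proof (intro allI)
  fix s m
  have "(\<lambda>N. \<Sum>p\<le>m. divided_diff (1 / real N) (f N) s p * divided_diff (1 / real N) (g N) (s + p) (m - p))
      \<longlonglongrightarrow> (\<Sum>p\<le>m. fps_nth \<phi> p * fps_nth \<psi> (m - p))"
    using assms by (intro tendsto_intros) (auto simp: taylor_limit_def)
  also have "(\<Sum>p\<le>m. fps_nth \<phi> p * fps_nth \<psi> (m - p)) = fps_nth (\<phi> * \<psi>) m"
    by (simp add: fps_mult_nth atLeast0AtMost)
  finally show "(\<lambda>N. divided_diff (1 / real N) (\<lambda>r. f N r * g N r) s m) \<longlonglongrightarrow> fps_nth (\<phi> * \<psi>) m"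
    by (rule Lim_transform_eventually)
       (auto intro!: eventually_mono[OF eventually_gt_at_top[of 0]] divided_diff_mult[symmetric])
qed

lemma taylor_limit_1: "taylor_limit (\<lambda>N r. 1) 1"
proof -
  have "divided_diff h (\<lambda>_. 1) s m = (if m = 0 then 1 else 0)" for h s m
    by (induction m arbitrary: s) auto
  then show ?thesis by (simp add: taylor_limit_def)
qed

lemma taylor_limit_prod:
  assumes "\<And>d. d \<in> D \<Longrightarrow> taylor_limit (f d) (\<phi> d)"
  shows "taylor_limit (\<lambda>N r. \<Prod>d\<in>D. f d N r) (\<Prod>d\<in>D. \<phi> d)"
  using assms
proof (induction D rule: infinite_finite_induct)
  case (insert d D)
  then show ?case by (simp add: taylor_limit_mult)
qed (auto simp: taylor_limit_1)

text \<open>The values are affine of slope 1 in the node, so all positive orders are exact for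
  \<open>N > 0\<close> and only order 0 needs a limit.\<close>

lemma taylor_limit_linear:
  assumes "\<alpha> \<longlonglongrightarrow> c"
  shows "taylor_limit (\<lambda>N r. \<alpha> N - real r / real N) (fps_const c + fps_X)"
  unfolding taylor_limit_def
proof (intro allI)
  fix s m
  have eq: "divided_diff (1 / real N) (\<lambda>r. \<alpha> N - real r / real N) s m =
      (if m = 0 then \<alpha> N - real s * (1 / real N) else if m = 1 then 1 else 0)" if "N > 0" for N
    using that by (induction m arbitrary: s) (auto simp: field_simps)
  have "(\<lambda>N. \<alpha> N - real s * (1 / real N)) \<longlonglongrightarrow> c - real s * 0"
    by (intro tendsto_intros assms lim_1_over_n)
  then have "(\<lambda>N. if m = 0 then \<alpha> N - real s * (1 / real N) else if m = 1 then 1 else 0)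
      \<longlonglongrightarrow> fps_nth (fps_const c + fps_X) m"
    by (cases m) auto
  then show "(\<lambda>N. divided_diff (1 / real N) (\<lambda>r. \<alpha> N - real r / real N) s m)
      \<longlonglongrightarrow> fps_nth (fps_const c + fps_X) m"
    by (rule Lim_transform_eventually)
       (auto intro!: eventually_mono[OF eventually_gt_at_top[of 0]] simp only: eq)
qed

text \<open>For nonzero \<open>c\<close>, the expansion of 1/(c + X).\<close>

definition fps_recip :: "real \<Rightarrow> real fps" where
  "fps_recip c = Abs_fps (\<lambda>m. (-1) ^ m / c ^ Suc m)"

text \<open>The products \<open>Q\<close> and \<open>P\<close> over adjacent windows differ only in
  the end factors \<open>u\<close> and \<open>v\<close>, and \<open>v - u\<close> is minus the step
  denominator \<open>h * Suc m\<close>, which therefore cancels.\<close>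

lemma divided_diff_recip:
  assumes "h \<noteq> 0" "\<And>i. i \<le> m \<Longrightarrow> \<alpha> - real (s + i) * h \<noteq> 0"
  shows "divided_diff h (\<lambda>r. 1 / (\<alpha> - real r * h)) s m = (-1) ^ m / (\<Prod>i\<le>m. \<alpha> - real (s + i) * h)"
  using assms(2)
proof (induction m arbitrary: s)
  case (Suc m)
  define P where "P = (\<Prod>i\<le>m. \<alpha> - real (Suc (s + i)) * h)"
  define Q where "Q = (\<Prod>i\<le>m. \<alpha> - real (s + i) * h)"
  define u where "u = \<alpha> - real s * h"
  define v where "v = \<alpha> - real (s + Suc m) * h"
  have nz: "P \<noteq> 0" "Q \<noteq> 0" "u \<noteq> 0" "v \<noteq> 0"
    using Suc.prems[of 0] Suc.prems[of "Suc _"] Suc.prems[of "Suc m"] Suc.prems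
    by (auto simp: P_def Q_def u_def v_def simp del: of_nat_add of_nat_Suc)
  have PQ: "(\<Prod>i\<le>Suc m. \<alpha> - real (s + i) * h) = Q * v" "Q * v = u * P"
    unfolding P_def Q_def u_def v_def
    by (simp, subst prod.atMost_Suc[symmetric], subst prod.atMost_Suc_shift, simp)
  have "divided_diff h (\<lambda>r. 1 / (\<alpha> - real r * h)) s m = (-1) ^ m / Q"
    using Suc by (simp add: Q_def)
  moreover have "divided_diff h (\<lambda>r. 1 / (\<alpha> - real r * h)) (Suc s) m = (-1) ^ m / P"
    using Suc.IH[of "Suc s"] Suc.prems[of "Suc _"] by (simp add: P_def)
  ultimately have "divided_diff h (\<lambda>r. 1 / (\<alpha> - real r * h)) s (Suc m) =
      (-1) ^ m * (1 / Q - 1 / P) / (h * real (Suc m))"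
    by (simp add: algebra_simps)
  also have "1 / Q = v / (Q * v)" using nz by simp
  also have "1 / P = u / (Q * v)" unfolding PQ using nz by simp
  also have "v / (Q * v) - u / (Q * v) = - (h * real (Suc m)) / (Q * v)"
    by (simp add: u_def v_def diff_divide_distrib[symmetric] algebra_simps)
  finally show ?case
    unfolding PQ(1) using assms(1) nz by (simp del: of_nat_Suc)
qed simp

lemma taylor_limit_recip:
  assumes "\<alpha> \<longlonglongrightarrow> c" "c > 0"
  shows "taylor_limit (\<lambda>N r. 1 / (\<alpha> N - real r / real N)) (fps_recip c)"
  unfolding taylor_limit_def
proof (intro allI)
  fix s m
  have lim: "(\<lambda>N. \<alpha> N - real r * (1 / real N)) \<longlonglongrightarrow> c" for r
    using tendsto_diff[OF assms(1) tendsto_mult[OF tendsto_const lim_1_over_n], of "real r"] by simp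
  \<comment> \<open>The closed form needs nonzero factors; only finitely many occur and each tends
    to \<open>c > 0\<close>.\<close>
  have ev: "\<forall>\<^sub>F N in sequentially. \<forall>i\<in>{..m}. \<alpha> N - real (s + i) * (1 / real N) > 0"
    by (intro eventually_ball_finite ballI order_tendstoD(1)[OF lim assms(2)]) auto
  have "(\<lambda>N. (-1) ^ m / (\<Prod>i\<le>m. \<alpha> N - real (s + i) * (1 / real N))) \<longlonglongrightarrow> (-1) ^ m / (\<Prod>i\<le>m. c)"
    using assms(2) by (intro tendsto_intros lim) auto
  then have "(\<lambda>N. (-1) ^ m / (\<Prod>i\<le>m. \<alpha> N - real (s + i) * (1 / real N))) \<longlonglongrightarrow> fps_nth (fps_recip c) m"
    by (simp add: fps_recip_def)
  then show "(\<lambda>N. divided_diff (1 / real N) (\<lambda>r. 1 / (\<alpha> N - real r / real N)) s m) \<longlonglongrightarrow> fps_nth (fps_recip c) m"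
  proof (rule Lim_transform_eventually)
    show "\<forall>\<^sub>F N in sequentially. (-1) ^ m / (\<Prod>i\<le>m. \<alpha> N - real (s + i) * (1 / real N)) =
        divided_diff (1 / real N) (\<lambda>r. 1 / (\<alpha> N - real r / real N)) s m"
      using ev eventually_gt_at_top[of 0]
    proof eventually_elim
      case (elim N)
      have "divided_diff (1 / real N) (\<lambda>r. 1 / (\<alpha> N - real r * (1 / real N))) s m =
          (-1) ^ m / (\<Prod>i\<le>m. \<alpha> N - real (s + i) * (1 / real N))"
      proof (rule divided_diff_recip)
        show "1 / real N \<noteq> 0" using elim(2) by simp
        show "\<alpha> N - real (s + i) * (1 / real N) \<noteq> 0" if "i \<le> m" for i
          using bspec[OF elim(1), of i] that by (metis atMost_iff less_irrefl)
      qed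
      then show ?case by simp
    qed
  qed
qed

text \<open>The negative binomial series; multiplying by one more factor sums the binomials by the
  hockey-stick identity.\<close>

lemma fps_recip_power_nth:
  assumes "c \<noteq> 0"
  shows "fps_nth (fps_recip c ^ Suc p) m = (-1) ^ m * real (p + m choose m) / c ^ (Suc p + m)"
proof (induction p arbitrary: m)
  case 0
  then show ?case by (simp add: fps_recip_def)
next
  case (Suc p)
  have "fps_nth (fps_recip c ^ Suc (Suc p)) m =
      (\<Sum>i\<le>m. fps_nth (fps_recip c ^ Suc p) i * fps_nth (fps_recip c) (m - i))"
    by (simp only: power_Suc2[of _ "Suc p"] fps_mult_nth atLeast0AtMost)
  also have "\<dots> = (\<Sum>i\<le>m. (-1) ^ m / c ^ (Suc (Suc p) + m) * real (p + i choose i))"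
  proof (intro sum.cong refl)
    fix i assume "i \<in> {..m}"
    then have "i \<le> m" by simp
    then have "(-1) ^ i * (-1) ^ (m - i) = ((-1) ^ m :: real)"
      "c ^ (Suc p + i) * c ^ Suc (m - i) = c ^ (Suc (Suc p) + m)"
      by (simp_all flip: power_add)
    moreover have "fps_nth (fps_recip c ^ Suc p) i * fps_nth (fps_recip c) (m - i) =
        ((-1) ^ i * (-1) ^ (m - i)) / (c ^ (Suc p + i) * c ^ Suc (m - i)) * real (p + i choose i)"
      unfolding Suc by (simp add: fps_recip_def mult_ac)
    ultimately show "fps_nth (fps_recip c ^ Suc p) i * fps_nth (fps_recip c) (m - i) =
        (-1) ^ m / c ^ (Suc (Suc p) + m) * real (p + i choose i)"
      by (simp only:)
  qed
  also have "\<dots> = (-1) ^ m / c ^ (Suc (Suc p) + m) * real (\<Sum>i\<le>m. p + i choose i)"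
    by (simp add: sum_distrib_left)
  finally show ?case by (simp add: sum_choose_lower)
qed

lemma fps_const_plus_X_power_nth:
  "fps_nth ((fps_const c + fps_X) ^ k) m = real (k choose m) * (c :: real) ^ (k - m)"
proof -
  have "(fps_const c + fps_X) ^ k = (\<Sum>i\<le>k. fps_const (real (k choose i) * c ^ (k - i)) * fps_X ^ i)"
    by (subst add.commute, subst binomial_ring)
       (simp add: fps_of_nat[symmetric] fps_const_power fps_const_mult[symmetric] mult_ac del: fps_const_mult)
  then have "fps_nth ((fps_const c + fps_X) ^ k) m =
      (\<Sum>i\<le>k. if m = i then real (k choose i) * c ^ (k - i) else 0)"
    by (simp add: fps_sum_nth fps_X_power_nth if_distrib[of "\<lambda>x. _ * x"] cong: if_cong)
  then show ?thesis by (simp add: sum.delta')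
qed

text \<open>Order \<open>j\<close> is taken from the reciprocal power, \<open>i\<close> from the
  power of 1 + X and the remaining \<open>k - 1 - j - i\<close> from the power of \<beta> + X;
  binomial symmetry turns the last choice into \<open>i + j + 1\<close>.\<close>

lemma coeff_limit_series:
  fixes \<beta> \<gamma> :: real
  assumes "\<gamma> \<noteq> 0" "k \<ge> 1"
  shows "fps_nth (((fps_const 1 + fps_X) * (fps_const \<beta> + fps_X) * fps_recip \<gamma>) ^ k) (k - 1) =
    \<beta> / \<gamma> ^ k * (\<Sum>j<k. (-1) ^ j * (\<beta> / \<gamma>) ^ j * real ((j + k - 1) choose j) *
       (\<Sum>i\<le>k - 1 - j. \<beta> ^ i * real (k choose (i + j + 1)) * real (k choose i)))"
proof -
  have "fps_nth (((fps_const 1 + fps_X) * (fps_const \<beta> + fps_X) * fps_recip \<gamma>) ^ k) (k - 1) =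
      fps_nth (fps_recip \<gamma> ^ k * ((fps_const 1 + fps_X) ^ k * (fps_const \<beta> + fps_X) ^ k)) (k - 1)"
    by (simp only: power_mult_distrib mult_ac)
  also have "\<dots> = (\<Sum>j<k. fps_nth (fps_recip \<gamma> ^ k) j *
      (\<Sum>i\<le>k - 1 - j. real (k choose i) * (real (k choose (k - 1 - j - i)) * \<beta> ^ (k - (k - 1 - j - i)))))"
  proof -
    have "{0..k - 1} = {..<k}" using assms by auto
    then show ?thesis
      by (simp only: fps_mult_nth fps_const_plus_X_power_nth atLeast0AtMost power_one mult_1_right)
  qed
  also have "\<dots> = (\<Sum>j<k. \<beta> / \<gamma> ^ k * ((-1) ^ j * (\<beta> / \<gamma>) ^ j * real ((j + k - 1) choose j) *
       (\<Sum>i\<le>k - 1 - j. \<beta> ^ i * real (k choose (i + j + 1)) * real (k choose i))))"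
  proof (intro sum.cong refl)
    fix j assume "j \<in> {..<k}"
    then have j: "j < k" by simp
    define S where "S = (\<Sum>i\<le>k - 1 - j. \<beta> ^ i * real (k choose (i + j + 1)) * real (k choose i))"
    obtain p where p: "k = Suc p" using assms by (cases k) auto
    have "fps_nth (fps_recip \<gamma> ^ k) j = (-1) ^ j * real ((j + k - 1) choose j) / \<gamma> ^ (k + j)"
      using fps_recip_power_nth[OF assms(1), of p j] by (simp add: p add.commute[of j p])
    then have recip: "fps_nth (fps_recip \<gamma> ^ k) j * (\<beta> ^ Suc j * S) =
        \<beta> / \<gamma> ^ k * ((-1) ^ j * (\<beta> / \<gamma>) ^ j * real ((j + k - 1) choose j) * S)"
      by (simp add: power_add power_divide)
    have "(\<Sum>i\<le>k - 1 - j. real (k choose i) * (real (k choose (k - 1 - j - i)) * \<beta> ^ (k - (k - 1 - j - i)))) =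
        (\<Sum>i\<le>k - 1 - j. \<beta> ^ Suc j * (\<beta> ^ i * real (k choose (i + j + 1)) * real (k choose i)))"
    proof (intro sum.cong refl)
      fix i assume "i \<in> {..k - 1 - j}"
      then have "i + j + 1 \<le> k" using j by auto
      then have "k choose (k - 1 - j - i) = k choose (i + j + 1)" "k - (k - 1 - j - i) = Suc j + i"
        using binomial_symmetric[of "i + j + 1" k] by (auto simp: diff_diff_eq add_ac)
      then show "real (k choose i) * (real (k choose (k - 1 - j - i)) * \<beta> ^ (k - (k - 1 - j - i))) =
          \<beta> ^ Suc j * (\<beta> ^ i * real (k choose (i + j + 1)) * real (k choose i))"
        by (simp only: power_add mult_ac)
    qed
    also have "\<dots> = \<beta> ^ Suc j * S"
      by (simp only: S_def sum_distrib_left)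
    finally show "fps_nth (fps_recip \<gamma> ^ k) j *
        (\<Sum>i\<le>k - 1 - j. real (k choose i) * (real (k choose (k - 1 - j - i)) * \<beta> ^ (k - (k - 1 - j - i)))) =
        \<beta> / \<gamma> ^ k * ((-1) ^ j * (\<beta> / \<gamma>) ^ j * real ((j + k - 1) choose j) *
       (\<Sum>i\<le>k - 1 - j. \<beta> ^ i * real (k choose (i + j + 1)) * real (k choose i)))"
      using recip by (simp only: S_def)
  qed
  finally show ?thesis by (simp only: sum_distrib_left)
qed

section \<open>The large-N limit\<close>

text \<open>Supplies \<open>k\<close> linear factors to pair with the \<open>k\<close> fractions of
  the moment formula.\<close>

lemma real_choose_eq_prod:
  assumes "r < N"
  shows "fact k * real (N - 1 - r + k choose k) = (\<Prod>d<k. real (N - r) + real d)"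
proof -
  have "real (N - 1 - r + k) - real k + 1 = real (N - r)" using assms by simp
  then have "real (N - 1 - r + k choose k) = pochhammer (real (N - r)) k / fact k"
    by (simp only: binomial_gbinomial gbinomial_pochhammer')
  then show ?thesis by (simp add: pochhammer_prod atLeast0LessThan)
qed

theorem theorem2:
  fixes a0 a1 b0 b1 :: real and k :: nat
  assumes "\<forall>N::nat. N \<ge> 1 \<longrightarrow> a1 * real N + a0 > 0"
      and "\<forall>N::nat. N \<ge> 1 \<longrightarrow> b1 * real N + b0 > 0"
      and "k \<ge> 1"
  shows "(\<lambda>N::nat. moment_I N (a1 * real N + a0) (b1 * real N + b0) k / real N)
    \<longlonglongrightarrow>
    (1 + a1) / (real k * (2 + a1 + b1) ^ k) *
    (\<Sum>j<k. (-1) ^ j * ((1 + a1) / (2 + a1 + b1)) ^ j * real ((j + k - 1) choose j) *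
       (\<Sum>i\<le>k - 1 - j. (1 + a1) ^ i * real (k choose (i + j + 1)) * real (k choose i)))"
proof -
  \<comment> \<open>A negative slope would make the parameter negative for large \<open>N\<close>.
    Nonnegative slopes give \<gamma> > 0, as the reciprocal factors require.\<close>
  have slope_nonneg: "u \<ge> 0" if "\<forall>N::nat. N \<ge> 1 \<longrightarrow> u * real N + v > 0" for u v :: real
  proof (rule ccontr)
    assume "\<not> u \<ge> 0"
    then have "u < 0" by simp
    obtain n :: nat where "v / - u < real n" using reals_Archimedean2 by blast
    then have "u * real (Suc n) + v < 0"
      using \<open>u < 0\<close> by (simp add: field_simps)
    moreover have "u * real (Suc n) + v > 0" using that by auto
    ultimately show False by simp
  qed
  have pos: "a1 \<ge> 0" "b1 \<ge> 0"
    using slope_nonneg assms(1,2) by auto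
  define \<gamma> where "\<gamma> = 2 + a1 + b1"
  define \<phi> where "\<phi> = (fps_const 1 + fps_X) * (fps_const (1 + a1) + fps_X) * fps_recip \<gamma>"
  have "\<gamma> > 0" using pos by (simp add: \<gamma>_def)
  \<comment> \<open>After subtracting \<open>r / N\<close> and multiplying by \<open>N\<close>,
    these are the factors \<open>N - r + d\<close>, \<open>a + N - 1 - r + d\<close> and
    \<open>a + b + 2 * N - 2 - r + d\<close>; their limits are the constants in \<phi>.\<close>
  define \<alpha>1 where "\<alpha>1 d N = 1 + real d * (1 / real N)" for d N :: nat
  define \<alpha>2 where "\<alpha>2 d N = 1 + a1 + (a0 - 1 + real d) * (1 / real N)" for d N :: nat
  define \<alpha>3 where "\<alpha>3 d N = \<gamma> + (a0 + b0 - 2 + real d) * (1 / real N)" for d N :: nat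
  define F where "F N r = (\<Prod>d<k. (\<alpha>1 d N - real r / real N) * (\<alpha>2 d N - real r / real N) *
    (1 / (\<alpha>3 d N - real r / real N)))" for N r :: nat
  have lin: "(\<lambda>N. c + e * (1 / real N)) \<longlonglongrightarrow> c" for c e :: real
    using tendsto_add[OF tendsto_const tendsto_mult[OF tendsto_const lim_1_over_n], of c e] by simp
  have "taylor_limit F (\<Prod>d<k. \<phi>)"
    unfolding F_def \<phi>_def
    by (intro taylor_limit_prod taylor_limit_mult taylor_limit_linear taylor_limit_recip \<open>\<gamma> > 0\<close>)
       (unfold \<alpha>1_def \<alpha>2_def \<alpha>3_def, (rule lin)+)
  then have "(\<lambda>N. divided_diff (1 / real N) (F N) 0 (k - 1)) \<longlonglongrightarrow> fps_nth (\<phi> ^ k) (k - 1)"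
    by (simp add: taylor_limit_def)
  then have lim: "(\<lambda>N. divided_diff (1 / real N) (F N) 0 (k - 1) / real k) \<longlonglongrightarrow> fps_nth (\<phi> ^ k) (k - 1) / real k"
    using assms(3) by (intro tendsto_divide tendsto_const) auto
  \<comment> \<open>For \<open>N \<ge> k\<close> the sum over \<open>r < N\<close> contains every
    \<open>r \<le> k - 1\<close>, and the other terms vanish with the binomial in
    \<open>k - 1\<close>.\<close>
  have "divided_diff (1 / real N) (F N) 0 (k - 1) / real k =
      moment_I N (a1 * real N + a0) (b1 * real N + b0) k / real N" if N: "N \<ge> k" for N
  proof -
    let ?a = "a1 * real N + a0" and ?b = "b1 * real N + b0"
    have N1: "N \<ge> 1" using N assms(3) by simp
    then have ab: "?a > 0" "?b > 0" using assms(1,2) by auto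
    have summand: "fact k * real (N - 1 - r + k choose k) *
        (\<Prod>d<k. (?a + real (N - 1 - r) + real d) / (?a + ?b + real (N - 1 - r) + real (N - 1) + real d))
        = real N ^ k * F N r" if r: "r < k" for r
    proof -
      have r': "r < N" using r N by simp
      have "fact k * real (N - 1 - r + k choose k) *
        (\<Prod>d<k. (?a + real (N - 1 - r) + real d) / (?a + ?b + real (N - 1 - r) + real (N - 1) + real d))
        = (\<Prod>d<k. (real (N - r) + real d) *
          ((?a + real (N - 1 - r) + real d) / (?a + ?b + real (N - 1 - r) + real (N - 1) + real d)))"
        unfolding real_choose_eq_prod[OF r'] by (rule prod.distrib[symmetric])
      \<comment> \<open>Two numerators and one denominator each carry a factor \<open>N\<close>,
        leaving one \<open>N\<close> for each \<open>d\<close>.\<close>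
      also have "\<dots> = (\<Prod>d<k. real N * ((\<alpha>1 d N - real r / real N) * (\<alpha>2 d N - real r / real N) *
          (1 / (\<alpha>3 d N - real r / real N))))"
      proof (intro prod.cong refl)
        fix d
        have e1: "real (N - r) + real d = real N * (\<alpha>1 d N - real r / real N)"
          and e2: "?a + real (N - 1 - r) + real d = real N * (\<alpha>2 d N - real r / real N)"
          and e3: "?a + ?b + real (N - 1 - r) + real (N - 1) + real d = real N * (\<alpha>3 d N - real r / real N)"
          using r' N1 by (simp_all add: \<alpha>1_def \<alpha>2_def \<alpha>3_def \<gamma>_def of_nat_diff field_simps)
        show "(real (N - r) + real d) *
          ((?a + real (N - 1 - r) + real d) / (?a + ?b + real (N - 1 - r) + real (N - 1) + real d)) =
          real N * ((\<alpha>1 d N - real r / real N) * (\<alpha>2 d N - real r / real N) *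
          (1 / (\<alpha>3 d N - real r / real N)))"
          unfolding e1 e2 e3 using N1 by simp
      qed
      also have "\<dots> = real N ^ k * F N r"
        by (subst prod.distrib) (simp add: F_def)
      finally show ?thesis .
    qed
    have "fact k * moment_I N ?a ?b k = (\<Sum>r<N. (-1) ^ r * real (k - 1 choose r) *
        (fact k * real (N - 1 - r + k choose k) *
        (\<Prod>d<k. (?a + real (N - 1 - r) + real d) / (?a + ?b + real (N - 1 - r) + real (N - 1) + real d))))"
      unfolding moment_I_eq[OF ab assms(3)] sum_distrib_left by (intro sum.cong refl) (simp only: mult_ac)
    also have "\<dots> = (\<Sum>r\<le>k - 1. (-1) ^ r * real (k - 1 choose r) * (real N ^ k * F N r))"
    proof (rule sum.mono_neutral_cong_right)
      fix r assume "r \<in> {..k - 1}"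
      then have "r < k" using assms(3) by auto
      then show "(-1) ^ r * real (k - 1 choose r) * (fact k * real (N - 1 - r + k choose k) *
          (\<Prod>d<k. (?a + real (N - 1 - r) + real d) / (?a + ?b + real (N - 1 - r) + real (N - 1) + real d))) =
          (-1) ^ r * real (k - 1 choose r) * (real N ^ k * F N r)"
        by (simp only: summand)
    qed (use N assms(3) in auto)
    also have "\<dots> = real N ^ k * (\<Sum>r\<le>k - 1. (-1) ^ r * real (k - 1 choose r) * F N (0 + r))"
      by (simp add: sum_distrib_left mult_ac)
    also have "\<dots> = real N ^ k * (fact (k - 1) * (1 / real N) ^ (k - 1) *
        divided_diff (1 / real N) (F N) 0 (k - 1))"
      using N1 by (subst divided_diff_eq_sum) auto
    finally have "fact k * moment_I N ?a ?b k = real N ^ k * (fact (k - 1) * (1 / real N) ^ (k - 1) *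
        divided_diff (1 / real N) (F N) 0 (k - 1))" .
    \<comment> \<open>With \<open>k = Suc p\<close> the factorials leave \<open>1 / k\<close> and
      the powers of \<open>N\<close> leave a single \<open>N\<close>.\<close>
    moreover obtain p where "k = Suc p" using assms(3) by (cases k) auto
    ultimately show ?thesis
      using N1 by (simp add: field_simps power_divide del: of_nat_Suc)
  qed
  then have ev: "\<forall>\<^sub>F N in sequentially. divided_diff (1 / real N) (F N) 0 (k - 1) / real k =
      moment_I N (a1 * real N + a0) (b1 * real N + b0) k / real N"
    by (intro eventually_sequentiallyI)
  have "fps_nth (\<phi> ^ k) (k - 1) / real k = (1 + a1) / (real k * (2 + a1 + b1) ^ k) *
    (\<Sum>j<k. (-1) ^ j * ((1 + a1) / (2 + a1 + b1)) ^ j * real ((j + k - 1) choose j) *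
       (\<Sum>i\<le>k - 1 - j. (1 + a1) ^ i * real (k choose (i + j + 1)) * real (k choose i)))"
    unfolding \<phi>_def using \<open>\<gamma> > 0\<close> assms(3)
    by (subst coeff_limit_series) (auto simp: \<gamma>_def)
  with Lim_transform_eventually[OF lim ev] show ?thesis by simp
qed

end
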